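(* Let $I$ be a Poisson ideal in a Poisson $C^\infty$-ring $\mathscr{A}$. Then the quotient $C^\infty$-ring $\mathscr{A}/I$ is Poisson and the projection map $p:\mathscr{A}\to\mathscr{A}/I$ is a map of Poisson $C^\infty$-rings.
   Context: A $C^\infty$-ring is a set $\mathscr{A}$ with an operation $f_{\mathscr{A}}:\mathscr{A}^n\to\mathscr{A}$ for each $n\geq 0$ and each $f\in C^\infty(\mathbb{R}^n)$, compatible with composition of smooth functions and sending coordinate functions to projections (equivalently, a product preserving functor from the category of spaces $\mathbb{R}^n$ and smooth maps to sets). It has an underlying commutative unital $\mathbb{R}$-algebra. Maps of $C^\infty$-rings are functions preserving all operations. An ideal in a $C^\infty$-ring is an ideal $I$ in the underlying $\mathbb{R}$-algebra; the quotient $\mathscr{A}/I$ is then a $C^\infty$-ring with the well-defined operations $f_{\mathscr{A}/I}(a_1+I,\ldots,a_n+I)=f_{\mathscr{A}}(a_1,\ldots,a_n)+I$. A Poisson $C^\infty$-ring is a $C^\infty$-ring $\mathscr{A}$ with a Poisson bracket on the underlying $\mathbb{R}$-algebra such that for each $a\in\mathscr{A}$ the map $\{a,\cdot\}$ is a $C^\infty$-ring derivation: $\{a, f_{\mathscr{A}}(a_1,\ldots,a_n)\} = \sum_{i=1}^n (\partial_i f)_{\mathscr{A}}(a_1,\ldots,a_n)\cdot\{a,a_i\}$ for all $n>0$, $f\in C^\infty(\mathbb{R}^n)$, $a_1,\dots,a_n\in\mathscr{A}$. A map of Poisson $C^\infty$-rings is a map of $C^\infty$-rings preserving the brackets. A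 Poisson ideal of $\mathscr{A}$ is an ideal $I$ with $\{f,a\}\in I$ for all $f\in I$, $a\in\mathscr{A}$. *)

theory Defs
  imports "HOL-Analysis.Analysis" "HOL-Algebra.Ideal" "HOL-Algebra.Module"
begin

(* Powers X^n are sets of extensional functions on {..<n}, both for R^n and for the n-tuples of
   elements of a ring.  A function on R^n is extensional as well, so that cinf n is literally
   the set of smooth functions R^n -> R (a HOL function has no spurious values off R^n). *)

definition tuples :: "nat \<Rightarrow> 'a set \<Rightarrow> (nat \<Rightarrow> 'a) set" where
  "tuples n X = {..<n} \<rightarrow>\<^sub>E X"

abbreviation Rn :: "nat \<Rightarrow> (nat \<Rightarrow> real) set" where
  "Rn n \<equiv> tuples n UNIV"

definition tuple :: "'a list \<Rightarrow> nat \<Rightarrow> 'a" where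
  "tuple xs = (\<lambda>i\<in>{..<length xs}. xs ! i)"

definition partial_deriv :: "nat \<Rightarrow> nat \<Rightarrow> ((nat \<Rightarrow> real) \<Rightarrow> real) \<Rightarrow> (nat \<Rightarrow> real) \<Rightarrow> real" where
  "partial_deriv n i f = (\<lambda>x\<in>Rn n. deriv (\<lambda>t. f (x(i := t))) (x i))"

primrec Ck :: "nat \<Rightarrow> nat \<Rightarrow> ((nat \<Rightarrow> real) \<Rightarrow> real) \<Rightarrow> bool" where
  "Ck 0 n f \<longleftrightarrow> continuous_map (powertop_real {..<n}) euclideanreal f"
| "Ck (Suc k) n f \<longleftrightarrow>
     continuous_map (powertop_real {..<n}) euclideanreal f \<and>
     (\<forall>i<n. (\<forall>x\<in>Rn n. (\<lambda>t. f (x(i := t))) field_differentiable at (x i)) \<and>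
            Ck k n (partial_deriv n i f))"

definition cinf :: "nat \<Rightarrow> ((nat \<Rightarrow> real) \<Rightarrow> real) set" where
  "cinf n = {f \<in> extensional (Rn n). \<forall>k. Ck k n f}"

record 'a cinf_ring = "'a partial_object" +
  cinf_op :: "nat \<Rightarrow> ((nat \<Rightarrow> real) \<Rightarrow> real) \<Rightarrow> (nat \<Rightarrow> 'a) \<Rightarrow> 'a"

locale cinf_ring =
  fixes A :: "'a cinf_ring"
  assumes op_closed:
      "\<lbrakk>f \<in> cinf n; a \<in> tuples n (carrier A)\<rbrakk> \<Longrightarrow> cinf_op A n f a \<in> carrier A"
    and op_coordinate:
      "\<lbrakk>i < n; a \<in> tuples n (carrier A)\<rbrakk> \<Longrightarrow> cinf_op A n (\<lambda>x\<in>Rn n. x i) a = a i"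
    and op_comp:
      "\<lbrakk>f \<in> cinf n; \<And>i. i < n \<Longrightarrow> g i \<in> cinf m; a \<in> tuples m (carrier A)\<rbrakk> \<Longrightarrow>
        cinf_op A m (\<lambda>x\<in>Rn m. f (\<lambda>i\<in>{..<n}. g i x)) a =
        cinf_op A n f (\<lambda>i\<in>{..<n}. cinf_op A m (g i) a)"

definition cinf_hom :: "'a cinf_ring \<Rightarrow> 'b cinf_ring \<Rightarrow> ('a \<Rightarrow> 'b) set" where
  "cinf_hom A B = {h \<in> carrier A \<rightarrow> carrier B.
     \<forall>n. \<forall>f\<in>cinf n. \<forall>a\<in>tuples n (carrier A).
       h (cinf_op A n f a) = cinf_op B n f (\<lambda>i\<in>{..<n}. h (a i))}"

(* The underlying R-algebra.  The ring axioms follow from those of a C^infinity-ring. *)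
definition underlying :: "'a cinf_ring \<Rightarrow> (real, 'a) module" where
  "underlying A =
    \<lparr>carrier = carrier A,
     mult = (\<lambda>a b. cinf_op A 2 (\<lambda>x\<in>Rn 2. x 0 * x 1) (tuple [a, b])),
     one = cinf_op A 0 (\<lambda>x\<in>Rn 0. 1) (tuple []),
     zero = cinf_op A 0 (\<lambda>x\<in>Rn 0. 0) (tuple []),
     add = (\<lambda>a b. cinf_op A 2 (\<lambda>x\<in>Rn 2. x 0 + x 1) (tuple [a, b])),
     smult = (\<lambda>r a. cinf_op A 1 (\<lambda>x\<in>Rn 1. r * x 0) (tuple [a]))\<rparr>"

(* As for multiplication of cosets in HOL-Algebra, the operation on cosets is the union of the
   results over all representatives; that this union is the single coset I + f(a) is part of
   the assertion that the projection is a map of C^infinity-rings. *)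
definition cinf_quot :: "'a cinf_ring \<Rightarrow> 'a set \<Rightarrow> 'a set cinf_ring" where
  "cinf_quot A I =
    \<lparr>carrier = a_rcosets\<^bsub>underlying A\<^esub> I,
     cinf_op = (\<lambda>n f X. \<Union>a\<in>Pi\<^sub>E {..<n} X. I +>\<^bsub>underlying A\<^esub> cinf_op A n f a)\<rparr>"

definition cinf_proj :: "'a cinf_ring \<Rightarrow> 'a set \<Rightarrow> 'a \<Rightarrow> 'a set" where
  "cinf_proj A I a = I +>\<^bsub>underlying A\<^esub> a"

locale poisson_bracket =
  fixes M :: "(real, 'a) module" (structure) and br :: "'a \<Rightarrow> 'a \<Rightarrow> 'a"
  assumes bracket_closed:
      "\<lbrakk>a \<in> carrier M; b \<in> carrier M\<rbrakk> \<Longrightarrow> br a b \<in> carrier M"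
    and bracket_add_left:
      "\<lbrakk>a \<in> carrier M; b \<in> carrier M; c \<in> carrier M\<rbrakk> \<Longrightarrow> br (a \<oplus> b) c = br a c \<oplus> br b c"
    and bracket_add_right:
      "\<lbrakk>a \<in> carrier M; b \<in> carrier M; c \<in> carrier M\<rbrakk> \<Longrightarrow> br a (b \<oplus> c) = br a b \<oplus> br a c"
    and bracket_smult_left:
      "\<lbrakk>a \<in> carrier M; b \<in> carrier M\<rbrakk> \<Longrightarrow> br (r \<odot> a) b = r \<odot> br a b"
    and bracket_smult_right:
      "\<lbrakk>a \<in> carrier M; b \<in> carrier M\<rbrakk> \<Longrightarrow> br a (r \<odot> b) = r \<odot> br a b"
    and bracket_antisym:
      "\<lbrakk>a \<in> carrier M; b \<in> carrier M\<rbrakk> \<Longrightarrow> br a b = \<ominus> br b a"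
    and bracket_jacobi:
      "\<lbrakk>a \<in> carrier M; b \<in> carrier M; c \<in> carrier M\<rbrakk> \<Longrightarrow>
        br a (br b c) \<oplus> br b (br c a) \<oplus> br c (br a b) = \<zero>"
    and bracket_leibniz:
      "\<lbrakk>a \<in> carrier M; b \<in> carrier M; c \<in> carrier M\<rbrakk> \<Longrightarrow>
        br a (b \<otimes> c) = br a b \<otimes> c \<oplus> b \<otimes> br a c"

definition cinf_derivation :: "'a cinf_ring \<Rightarrow> ('a \<Rightarrow> 'a) \<Rightarrow> bool" where
  "cinf_derivation A D \<longleftrightarrow> D \<in> carrier A \<rightarrow> carrier A \<and>
    (\<forall>n>0. \<forall>f\<in>cinf n. \<forall>a\<in>tuples n (carrier A).
      D (cinf_op A n f a) =
        (\<Oplus>\<^bsub>underlying A\<^esub>i\<in>{..<n}.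
           cinf_op A n (partial_deriv n i f) a \<otimes>\<^bsub>underlying A\<^esub> D (a i)))"

locale poisson_cinf_ring =
  cinf_ring A + poisson_bracket "underlying A" br
  for A :: "'a cinf_ring" and br :: "'a \<Rightarrow> 'a \<Rightarrow> 'a" +
  assumes bracket_derivation: "a \<in> carrier A \<Longrightarrow> cinf_derivation A (br a)"

definition poisson_ideal :: "'a set \<Rightarrow> 'a cinf_ring \<Rightarrow> ('a \<Rightarrow> 'a \<Rightarrow> 'a) \<Rightarrow> bool" where
  "poisson_ideal I A br \<longleftrightarrow>
    ideal I (underlying A) \<and> (\<forall>f\<in>I. \<forall>a\<in>carrier A. br f a \<in> I)"

definition poisson_hom ::
  "'a cinf_ring \<Rightarrow> ('a \<Rightarrow> 'a \<Rightarrow> 'a) \<Rightarrow> 'b cinf_ring \<Rightarrow> ('b \<Rightarrow> 'b \<Rightarrow> 'b) \<Rightarrow> ('a \<Rightarrow> 'b) set" where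
  "poisson_hom A brA B brB = {h \<in> cinf_hom A B.
     \<forall>a\<in>carrier A. \<forall>b\<in>carrier A. h (brA a b) = brB (h a) (h b)}"

end

theory Submission
  imports Defs "HOL-Algebra.QuotRing" "HOL-Algebra.UnivPoly"
begin

text \<open>
  What has to be proved is that everything on \<open>A\<close> depends only on cosets of \<open>I\<close>. Once an
  operation is known to descend, every identity of the quotient is the image, under the surjective
  projection, of the corresponding identity of \<open>A\<close>.

  For the bracket, descent is immediate: changing an argument by an element of \<open>I\<close> changes the
  value by a bracket with that element, which lies in the Poisson ideal (\<open>proj_bracket_cong\<close>).

  For the operation of a smooth function \<open>f\<close> it rests on Hadamard's lemma. Arguments may be
  changed one at a time, so the lemma is needed in one variable only, with the new value as
  an additional coordinate:
  \<open>f(x) - f(x(i := x\<^sub>n)) = (x\<^sub>i - x\<^sub>n) g(x, x\<^sub>n)\<close> with \<open>g\<close> smooth (\<open>hadamard_one_variable\<close>).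
  Evaluating this identity in \<open>A\<close> shows that replacing \<open>a\<^sub>i\<close> by a congruent \<open>b\<close> changes \<open>f(a)\<close> by a
  multiple of \<open>a\<^sub>i - b \<in> I\<close> (\<open>proj_op_upd\<close>).

  The function \<open>g\<close> is the integral of the \<open>i\<close>-th partial derivative of \<open>f\<close> along the segment between
  the two points. Its smoothness is proved for the whole family of integrals with a continuous
  weight in front of the integrand: by the chain rule along the segment, a partial derivative of such an integral is an
  integral of the same kind, with the weight multiplied by \<open>1\<close>, \<open>s\<close> or \<open>1 - s\<close>. The family is thus
  closed under partial derivatives, and an induction on the order of differentiability goes through
  without any chain rule in several variables.
\<close>

section \<open>Smooth functions\<close>

lemma tuplesI:
  assumes "\<And>i. i < n \<Longrightarrow> a i \<in> X"
  shows "(\<lambda>i\<in>{..<n}. a i) \<in> tuples n X"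
  using assms by (auto simp: tuples_def)

lemma tuples_memb: "a \<in> tuples n X \<Longrightarrow> i < n \<Longrightarrow> a i \<in> X"
  by (auto simp: tuples_def)

lemma tuples_restrict: "a \<in> tuples n X \<Longrightarrow> (\<lambda>i\<in>{..<n}. a i) = a"
  by (auto simp: tuples_def)

lemma tuples_upd: "a \<in> tuples n X \<Longrightarrow> i < n \<Longrightarrow> t \<in> X \<Longrightarrow> a(i := t) \<in> tuples n X"
  by (auto simp: tuples_def PiE_iff extensional_def)

text \<open>
  Extending \<open>f\<close> to all sequences through restriction moves continuity to a type of class
  \<^class>\<open>topological_space\<close>, where the theorem on the continuity of parameter integrals applies.
\<close>

lemma continuous_Rn_iff:
  "continuous_map (powertop_real {..<n}) euclideanreal f \<longleftrightarrow>
    continuous_on UNIV (\<lambda>y::nat \<Rightarrow> real. f (restrict y {..<n}))"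
proof
  assume f: "continuous_map (powertop_real {..<n}) euclideanreal f"
  have "continuous_map (powertop_real UNIV) (powertop_real {..<n}) (\<lambda>y. restrict y {..<n})"
  proof (rule continuous_map_coordinatewise_then_product)
    fix i assume "i \<in> {..<n}"
    then show "continuous_map (powertop_real UNIV) euclideanreal (\<lambda>y. restrict y {..<n} i)"
      using continuous_map_product_projection[of i UNIV "\<lambda>_. euclideanreal"] by simp
  qed simp
  from continuous_map_compose[OF this f]
  show "continuous_on UNIV (\<lambda>y::nat \<Rightarrow> real. f (restrict y {..<n}))"
    by (simp add: euclidean_product_topology o_def)
next
  assume "continuous_on UNIV (\<lambda>y::nat \<Rightarrow> real. f (restrict y {..<n}))"
  then have f: "continuous_map (powertop_real UNIV) euclideanreal (\<lambda>y. f (restrict y {..<n}))"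
    by (simp add: euclidean_product_topology)
  have "continuous_map (powertop_real {..<n}) euclideanreal (\<lambda>y. y i)" for i
  proof (cases "i < n")
    case True
    then show ?thesis by (intro continuous_map_product_projection) simp
  next
    case False
    show ?thesis
    proof (rule continuous_map_eq[where f = "\<lambda>y. undefined"])
      fix y assume "y \<in> topspace (powertop_real {..<n})"
      then show "undefined = y i"
        using False PiE_arb[of y "{..<n}" "\<lambda>_. UNIV" i] by simp
    qed simp
  qed
  then have "continuous_map (powertop_real {..<n}) (powertop_real UNIV) (\<lambda>y. y)"
    by (simp add: continuous_map_componentwise_UNIV)
  from continuous_map_compose[OF this f]
  show "continuous_map (powertop_real {..<n}) euclideanreal f"
    by (rule continuous_map_eq) (simp add: PiE_restrict)
qed

lemma Ck_continuous: "Ck k n f \<Longrightarrow> continuous_map (powertop_real {..<n}) euclideanreal f"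
  by (cases k) auto

lemma Ck_SucD: "Ck (Suc k) n f \<Longrightarrow> Ck k n f"
  by (induction k arbitrary: f) auto

text \<open>
  Differentiability is known at every point of the coordinate line through \<open>x\<close>, since that line stays
  in \<open>Rn n\<close>; the free point \<open>v\<close> is what compositions with a curve along the line need.
\<close>

lemma has_partial_deriv:
  assumes "Ck (Suc k) n f" "i < n" "x \<in> Rn n"
  shows "((\<lambda>t. f (x(i := t))) has_field_derivative partial_deriv n i f (x(i := v))) (at v)"
proof -
  have x: "x(i := v) \<in> Rn n" using assms by (simp add: tuples_upd)
  have "\<forall>y\<in>Rn n. (\<lambda>t. f (y(i := t))) field_differentiable at (y i)"
    using assms by simp
  from bspec[OF this x] have "(\<lambda>t. f (x(i := t))) field_differentiable at v"
    by simp
  then show ?thesis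
    using x by (simp add: partial_deriv_def field_differentiable_derivI)
qed

lemma Ck_cong:
  assumes "\<And>x. x \<in> Rn n \<Longrightarrow> f x = g x"
  shows "Ck k n f \<longleftrightarrow> Ck k n g"
proof -
  have c: "continuous_map (powertop_real {..<n}) euclideanreal f \<longleftrightarrow>
      continuous_map (powertop_real {..<n}) euclideanreal g"
  proof -
    have "f x = g x" if "x \<in> topspace (powertop_real {..<n})" for x
      using assms that by (simp add: tuples_def)
    then show ?thesis
      using continuous_map_eq[of _ _ f g] continuous_map_eq[of _ _ g f] by fastforce
  qed
  have u: "(\<lambda>t. f (x(i := t))) = (\<lambda>t. g (x(i := t)))" if "x \<in> Rn n" "i < n" for x i
    using assms that by (simp add: tuples_upd)
  then have "partial_deriv n i f = partial_deriv n i g" if "i < n" for i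
    unfolding partial_deriv_def using that by (intro restrict_ext) simp
  with c u show ?thesis by (cases k) auto
qed

lemma Ck_restrict: "Ck k n (restrict f (Rn n)) \<longleftrightarrow> Ck k n f"
  by (rule Ck_cong) simp

text \<open>
  Introduction rule for inductions on the order: the derivative is read off from the derivative
  rules and may have any values off \<open>Rn n\<close>.
\<close>

lemma Ck_SucI:
  assumes "continuous_map (powertop_real {..<n}) euclideanreal f"
    and f': "\<And>i. i < n \<Longrightarrow> Ck k n (f' i)"
    and D: "\<And>i x. i < n \<Longrightarrow> x \<in> Rn n \<Longrightarrow>
        ((\<lambda>t. f (x(i := t))) has_field_derivative f' i x) (at (x i))"
  shows "Ck (Suc k) n f"
proof -
  have "partial_deriv n i f = restrict (f' i) (Rn n)" if "i < n" for i
    unfolding partial_deriv_def using that D by (intro restrict_ext DERIV_imp_deriv) auto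
  then have "Ck k n (partial_deriv n i f)" if "i < n" for i
    using that f' by (simp add: Ck_restrict)
  moreover have "(\<lambda>t. f (x(i := t))) field_differentiable at (x i)" if "i < n" "x \<in> Rn n" for i x
    using D[OF that] by (auto simp: field_differentiable_def)
  ultimately show ?thesis
    using assms(1) by simp
qed

lemma Ck_const: "Ck k n (\<lambda>x. c)"
proof (induction k arbitrary: c)
  case (Suc k)
  show ?case
    by (rule Ck_SucI[where f' = "\<lambda>_ _. 0"]) (auto simp: Suc.IH)
qed simp

lemma Ck_coordinate:
  assumes "i < n"
  shows "Ck k n (\<lambda>x. x i)"
proof -
  have cont: "continuous_map (powertop_real {..<n}) euclideanreal (\<lambda>x. x i)"
    using assms by (intro continuous_map_product_projection) simp
  show ?thesis
  proof (cases k)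
    case 0
    with cont show ?thesis by simp
  next
    case (Suc l)
    have "Ck (Suc l) n (\<lambda>x. x i)"
    proof (rule Ck_SucI[OF cont])
      fix j x
      show "((\<lambda>t. (x(j := t)) i) has_field_derivative (if j = i then 1 else 0)) (at (x j))"
        by simp
    qed (rule Ck_const)
    with Suc show ?thesis by simp
  qed
qed

lemma Ck_add: "Ck k n f \<Longrightarrow> Ck k n g \<Longrightarrow> Ck k n (\<lambda>x. f x + g x)"
proof (induction k arbitrary: f g)
  case 0
  then show ?case by (simp add: continuous_map_add)
next
  case (Suc k)
  show ?case
  proof (rule Ck_SucI)
    fix i x assume i: "i < n" and x: "x \<in> Rn n"
    show "((\<lambda>t. f (x(i := t)) + g (x(i := t))) has_field_derivative
        partial_deriv n i f x + partial_deriv n i g x) (at (x i))"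
      using DERIV_add[OF has_partial_deriv[OF Suc.prems(1) i x, of "x i"]
          has_partial_deriv[OF Suc.prems(2) i x, of "x i"]]
      by (simp only: fun_upd_triv)
  next
    show "continuous_map (powertop_real {..<n}) euclideanreal (\<lambda>x. f x + g x)"
      by (rule continuous_map_add) (use Suc.prems in auto)
  qed (use Suc in auto)
qed

lemma Ck_mult: "Ck k n f \<Longrightarrow> Ck k n g \<Longrightarrow> Ck k n (\<lambda>x. f x * g x)"
proof (induction k arbitrary: f g)
  case 0
  then show ?case by (simp add: continuous_map_real_mult)
next
  case (Suc k)
  show ?case
  proof (rule Ck_SucI)
    fix i x assume i: "i < n" and x: "x \<in> Rn n"
    show "((\<lambda>t. f (x(i := t)) * g (x(i := t))) has_field_derivative
        partial_deriv n i f x * g x + f x * partial_deriv n i g x) (at (x i))"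
      using DERIV_mult[OF has_partial_deriv[OF Suc.prems(1) i x, of "x i"]
          has_partial_deriv[OF Suc.prems(2) i x, of "x i"]]
      by (simp only: fun_upd_triv mult.commute[of "partial_deriv n i g x"])
  next
    fix i assume "i < n"
    then show "Ck k n (\<lambda>x. partial_deriv n i f x * g x + f x * partial_deriv n i g x)"
      using Suc.prems Ck_SucD[OF Suc.prems(1)] Ck_SucD[OF Suc.prems(2)]
      by (intro Ck_add Suc.IH) auto
  next
    show "continuous_map (powertop_real {..<n}) euclideanreal (\<lambda>x. f x * g x)"
      by (rule continuous_map_real_mult) (use Suc.prems in auto)
  qed
qed

text \<open>
  For injective \<open>\<sigma>\<close> each variable of the new function enters through at most one argument of \<open>f\<close>, so
  its partial derivatives are reindexed partial derivatives of \<open>f\<close> or zero.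
\<close>

lemma Ck_reindex:
  assumes \<sigma>: "inj_on \<sigma> {..<n}" "\<And>j. j < n \<Longrightarrow> \<sigma> j < m"
  shows "Ck k n f \<Longrightarrow> Ck k m (\<lambda>x. f (\<lambda>j\<in>{..<n}. x (\<sigma> j)))"
proof -
  have cont: "continuous_map (powertop_real {..<m}) euclideanreal (\<lambda>x. f (\<lambda>j\<in>{..<n}. x (\<sigma> j)))"
    if "continuous_map (powertop_real {..<n}) euclideanreal f" for f
  proof -
    have "continuous_map (powertop_real {..<m}) (powertop_real {..<n}) (\<lambda>x. \<lambda>j\<in>{..<n}. x (\<sigma> j))"
    proof (rule continuous_map_coordinatewise_then_product)
      fix j assume "j \<in> {..<n}"
      then show "continuous_map (powertop_real {..<m}) euclideanreal (\<lambda>x. (\<lambda>j\<in>{..<n}. x (\<sigma> j)) j)"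
        using continuous_map_product_projection[of "\<sigma> j" "{..<m}" "\<lambda>_. euclideanreal"] \<sigma>(2) by simp
    qed simp
    from continuous_map_compose[OF this that] show ?thesis
      unfolding o_def .
  qed
  show "Ck k n f \<Longrightarrow> Ck k m (\<lambda>x. f (\<lambda>j\<in>{..<n}. x (\<sigma> j)))"
  proof (induction k arbitrary: f)
    case 0
    with cont[of f] show ?case by (simp only: Ck.simps)
  next
    case (Suc k)
    define f' where "f' i x = (if i \<in> \<sigma> ` {..<n}
      then partial_deriv n (inv_into {..<n} \<sigma> i) f (\<lambda>j\<in>{..<n}. x (\<sigma> j)) else 0)" for i x
    show ?case
    proof (rule Ck_SucI[where f' = f'])
      show "continuous_map (powertop_real {..<m}) euclideanreal (\<lambda>x. f (\<lambda>j\<in>{..<n}. x (\<sigma> j)))"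
        using Suc.prems by (rule cont[OF Ck_continuous])
    next
      fix i x assume i: "i < m" and x: "x \<in> Rn m"
      show "((\<lambda>t. f (\<lambda>j\<in>{..<n}. (x(i := t)) (\<sigma> j))) has_field_derivative f' i x) (at (x i))"
      proof (cases "i \<in> \<sigma> ` {..<n}")
        case True
        then obtain l where l: "l < n" "i = \<sigma> l" by auto
        have upd: "(\<lambda>j\<in>{..<n}. (x(i := t)) (\<sigma> j)) = (\<lambda>j\<in>{..<n}. x (\<sigma> j))(l := t)" for t
          using l \<sigma>(1) by (auto simp: fun_eq_iff inj_on_def)
        have same: "(\<lambda>j\<in>{..<n}. x (\<sigma> j))(l := x i) = (\<lambda>j\<in>{..<n}. x (\<sigma> j))"
          using l by auto
        have f'x: "f' i x = partial_deriv n l f (\<lambda>j\<in>{..<n}. x (\<sigma> j))"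
          using l \<sigma>(1) by (simp add: f'_def)
        have "((\<lambda>t. f ((\<lambda>j\<in>{..<n}. x (\<sigma> j))(l := t))) has_field_derivative
            partial_deriv n l f ((\<lambda>j\<in>{..<n}. x (\<sigma> j))(l := x i))) (at (x i))"
          by (rule has_partial_deriv[OF Suc.prems l(1) tuplesI]) simp
        then show ?thesis
          unfolding upd same f'x .
      next
        case False
        then have "(\<lambda>j\<in>{..<n}. (x(i := t)) (\<sigma> j)) = (\<lambda>j\<in>{..<n}. x (\<sigma> j))" for t
          by (intro restrict_ext) auto
        with False show ?thesis by (simp add: f'_def)
      qed
    next
      fix i assume "i < m"
      show "Ck k m (f' i)"
      proof (cases "i \<in> \<sigma> ` {..<n}")
        case True
        then have "inv_into {..<n} \<sigma> i < n"
          using inv_into_into[of i \<sigma> "{..<n}"] by simp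
        then have "Ck k n (partial_deriv n (inv_into {..<n} \<sigma> i) f)"
          using Suc.prems by simp
        from Suc.IH[OF this] True show ?thesis
          by (simp only: f'_def[abs_def] if_True)
      qed (simp add: f'_def[abs_def] Ck_const)
    qed
  qed
qed

lemma cinf_restrictI: "(\<And>k. Ck k n f) \<Longrightarrow> (\<lambda>x\<in>Rn n. f x) \<in> cinf n"
  by (simp add: cinf_def Ck_restrict)

lemma cinf_Ck: "f \<in> cinf n \<Longrightarrow> Ck k n f"
  by (simp add: cinf_def)

lemma cinf_partial_deriv:
  assumes "f \<in> cinf n" "i < n"
  shows "partial_deriv n i f \<in> cinf n"
proof -
  have "Ck k n (partial_deriv n i f)" for k
    using cinf_Ck[OF assms(1), of "Suc k"] assms(2) by simp
  moreover have "partial_deriv n i f \<in> extensional (Rn n)"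
    unfolding partial_deriv_def by simp
  ultimately show ?thesis
    unfolding cinf_def by blast
qed

section \<open>Hadamard's lemma in one variable\<close>

text \<open>
  The \<open>n\<close>-th coordinate of \<open>x\<close> serves as the second value of the \<open>i\<close>-th variable: the segment runs
  from \<open>x(i := x n)\<close> at \<open>s = 0\<close> to \<open>x\<close> at \<open>s = 1\<close>, both cut down to their first \<open>n\<close> coordinates.
\<close>

definition segment :: "nat \<Rightarrow> nat \<Rightarrow> (nat \<Rightarrow> real) \<Rightarrow> real \<Rightarrow> nat \<Rightarrow> real" where
  "segment n i x s = (\<lambda>j\<in>{..<n}. if j = i then x n + s * (x i - x n) else x j)"

text \<open>
  The weight \<open>p\<close> is there to make this family closed under partial derivatives.
\<close>

definition segment_integral ::
  "nat \<Rightarrow> nat \<Rightarrow> (real \<Rightarrow> real) \<Rightarrow> ((nat \<Rightarrow> real) \<Rightarrow> real) \<Rightarrow> (nat \<Rightarrow> real) \<Rightarrow> real" where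
  "segment_integral n i p h =
    (\<lambda>x. integral {0..1} (\<lambda>s. p s * h (segment n i x s)))"

lemma segment_in_Rn: "segment n i x s \<in> Rn n"
  unfolding segment_def by (rule tuplesI) simp

lemma continuous_on_segment:
  assumes h: "continuous_map (powertop_real {..<n}) euclideanreal h"
    and p: "continuous_on {0..1} p"
  shows "continuous_on (UNIV \<times> {0..1}) (\<lambda>(y, s). p s * h (segment n i y s))"
proof -
  define e where "e = (\<lambda>(y :: nat \<Rightarrow> real, s) j. if j = i then y n + s * (y i - y n) else y j)"
  have coord: "continuous_on UNIV (\<lambda>z :: (nat \<Rightarrow> real) \<times> real. fst z j)" for j
    by (rule continuous_on_product_then_coordinatewise) (intro continuous_intros)
  have "continuous_on UNIV e"
  proof (rule continuous_on_coordinatewise_then_product)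
    fix j
    show "continuous_on UNIV (\<lambda>z. e z j)"
      unfolding e_def by (cases "j = i") (auto simp: case_prod_unfold intro!: continuous_intros coord)
  qed
  then have "continuous_on UNIV (\<lambda>z. h (restrict (e z) {..<n}))"
    by (intro continuous_on_compose2[OF h[unfolded continuous_Rn_iff]]) auto
  then have "continuous_on (UNIV \<times> {0..1}) (\<lambda>z. h (restrict (e z) {..<n}))"
    by (rule continuous_on_subset) simp
  moreover have "restrict (e z) {..<n} = segment n i (fst z) (snd z)" for z
    by (auto simp: e_def segment_def case_prod_unfold)
  ultimately have "continuous_on (UNIV \<times> {0..1}) (\<lambda>z. h (segment n i (fst z) (snd z)))"
    by (simp only:)
  moreover have "continuous_on (UNIV \<times> {0..1}) (\<lambda>z :: (nat \<Rightarrow> real) \<times> real. p (snd z))"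
    by (rule continuous_on_compose2[OF p]) (auto intro: continuous_intros)
  ultimately show ?thesis
    unfolding case_prod_unfold by (intro continuous_on_mult)
qed

lemma continuous_segment_integral:
  assumes h: "continuous_map (powertop_real {..<n}) euclideanreal h"
    and p: "continuous_on {0..1} p"
    and i: "i < n"
  shows "continuous_map (powertop_real {..<Suc n}) euclideanreal (segment_integral n i p h)"
proof -
  have "segment n i (restrict y {..<Suc n}) s = segment n i y s" for y s
    using i by (auto simp: segment_def)
  moreover have "continuous_on UNIV (\<lambda>y. integral (cbox 0 1) (\<lambda>s. p s * h (segment n i y s)))"
    using continuous_on_segment[OF h p] by (intro integral_continuous_on_param) simp
  ultimately show ?thesis
    by (simp add: segment_integral_def[abs_def] continuous_Rn_iff)
qed

text \<open>
  As a function of the \<open>j\<close>-th coordinate alone, the segment point moves in a single coordinate of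
  \<open>Rn n\<close>, with speed \<open>1 - s\<close> for \<open>j = n\<close>, \<open>s\<close> for \<open>j = i\<close> and \<open>1\<close> otherwise. Differentiation under the
  integral sign therefore multiplies the weight by that speed.
\<close>

lemma segment_integral_has_partial_deriv:
  assumes h: "Ck (Suc k) n h" and p: "continuous_on {0..1} p"
    and i: "i < n" and j: "j < Suc n"
  shows "((\<lambda>t. segment_integral n i p h (x(j := t))) has_field_derivative
    segment_integral n i (\<lambda>s. p s * (if j = n then 1 - s else if j = i then s else 1))
      (partial_deriv n (if j = n then i else j) h) x) (at (x j))"
proof -
  define c where "c s = (if j = n then 1 - s else if j = i then s else 1)" for s :: real
  define l where "l = (if j = n then i else j)"
  have l: "l < n" using i j by (auto simp: l_def)
  have cp: "continuous_on {0..1} (\<lambda>s. p s * c s)"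
    unfolding c_def by (cases "j = n"; cases "j = i") (auto intro!: continuous_intros p)
  have h': "continuous_map (powertop_real {..<n}) euclideanreal (partial_deriv n l h)"
    using h l Ck_continuous by auto
  have upd: "continuous_on UNIV (\<lambda>t. x(j := t))"
  proof (rule continuous_on_coordinatewise_then_product)
    show "continuous_on UNIV (\<lambda>t. (x(j := t)) m)" for m
      by (cases "m = j") auto
  qed
  have "((\<lambda>t. integral (cbox 0 1) (\<lambda>s. p s * h (segment n i (x(j := t)) s))) has_field_derivative
      integral (cbox 0 1) (\<lambda>s. p s * c s * partial_deriv n l h (segment n i (x(j := x j)) s)))
      (at (x j) within UNIV)"
  proof (rule leibniz_rule_field_derivative)
    fix t s :: real
    \<comment> \<open>the part of the moving coordinate that does not depend on \<open>t\<close>\<close>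
    define b where "b = (if j = n then s * x i else if j = i then (1 - s) * x n else 0)"
    have eq: "segment n i (x(j := u)) s = (segment n i x s)(l := b + c s * u)" for u
      using i j by (auto simp: segment_def fun_eq_iff l_def b_def c_def algebra_simps)
    have "((\<lambda>v. h ((segment n i x s)(l := v))) has_field_derivative
        partial_deriv n l h ((segment n i x s)(l := b + c s * t))) (at (b + c s * t))"
      by (rule has_partial_deriv[OF h l segment_in_Rn])
    moreover have "((\<lambda>t. b + c s * t) has_field_derivative c s) (at t)"
      by (auto intro!: derivative_eq_intros)
    ultimately have "((\<lambda>t. h ((segment n i x s)(l := b + c s * t))) has_field_derivative
        partial_deriv n l h ((segment n i x s)(l := b + c s * t)) * c s) (at t)"
      by (rule DERIV_chain2)
    then show "((\<lambda>t. p s * h (segment n i (x(j := t)) s)) has_field_derivative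
        p s * c s * partial_deriv n l h (segment n i (x(j := t)) s)) (at t within UNIV)"
      unfolding eq by (auto intro!: derivative_eq_intros)
  next
    fix t
    have "continuous_on {0..1} (\<lambda>s. (\<lambda>(y, s). p s * h (segment n i y s)) (x(j := t), s))"
      by (rule continuous_on_compose2[OF continuous_on_segment[OF Ck_continuous[OF h] p]])
        (auto intro!: continuous_intros)
    then show "(\<lambda>s. p s * h (segment n i (x(j := t)) s)) integrable_on cbox 0 1"
      by (simp add: integrable_continuous_real)
  next
    have "continuous_on (UNIV \<times> {0..1}) (\<lambda>z. (x(j := fst z), snd z))"
      by (intro continuous_on_Pair continuous_on_compose2[OF upd] continuous_intros) auto
    then have "continuous_on (UNIV \<times> {0..1})
        (\<lambda>z. (\<lambda>(y, s). p s * c s * partial_deriv n l h (segment n i y s)) (x(j := fst z), snd z))"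
      by (rule continuous_on_compose2[OF continuous_on_segment[OF h' cp]]) auto
    then show "continuous_on (UNIV \<times> cbox 0 1)
        (\<lambda>(t, s). p s * c s * partial_deriv n l h (segment n i (x(j := t)) s))"
      by (simp add: case_prod_unfold)
  qed auto
  then show ?thesis
    by (simp add: segment_integral_def c_def l_def)
qed

lemma Ck_segment_integral:
  assumes "i < n"
  shows "Ck k n h \<Longrightarrow> continuous_on {0..1} p \<Longrightarrow> Ck k (Suc n) (segment_integral n i p h)"
proof (induction k arbitrary: h p)
  case 0
  then show ?case using assms by (simp add: continuous_segment_integral)
next
  case (Suc k)
  show ?case
  proof (rule Ck_SucI[OF _ _ segment_integral_has_partial_deriv[OF Suc.prems assms]])
    fix j assume j: "j < Suc n"
    have "continuous_on {0..1} (\<lambda>s::real. p s * (if j = n then 1 - s else if j = i then s else 1))"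
      by (cases "j = n"; cases "j = i") (auto intro!: continuous_intros Suc.prems)
    then show "Ck k (Suc n) (segment_integral n i
        (\<lambda>s. p s * (if j = n then 1 - s else if j = i then s else 1))
        (partial_deriv n (if j = n then i else j) h))"
      using j assms Suc.prems by (intro Suc.IH) auto
  qed (use assms Suc.prems in \<open>auto intro: continuous_segment_integral\<close>)
qed

text \<open>
  The fundamental theorem of calculus along the segment, whose speed is \<open>x i - x n\<close>.
\<close>

lemma hadamard_one_variable:
  assumes f: "f \<in> cinf n" and i: "i < n"
  obtains g where "g \<in> cinf (Suc n)"
    and "\<And>x. x \<in> Rn (Suc n) \<Longrightarrow>
      f (\<lambda>j\<in>{..<n}. x j) - f (\<lambda>j\<in>{..<n}. if j = i then x n else x j) = (x i - x n) * g x"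
proof
  define f' where "f' = partial_deriv n i f"
  define g where "g = segment_integral n i (\<lambda>_. 1) f'"
  have f': "Ck k n f'" for k
    unfolding f'_def by (intro cinf_Ck cinf_partial_deriv f i)
  show "restrict g (Rn (Suc n)) \<in> cinf (Suc n)"
    unfolding g_def by (intro cinf_restrictI Ck_segment_integral i f') simp
  fix x assume x: "x \<in> Rn (Suc n)"
  define b where "b s = x n + s * (x i - x n)" for s
  have upd: "segment n i x s = (segment n i x 0)(i := b s)" for s
    using i by (auto simp: segment_def fun_eq_iff b_def)
  have deriv: "((\<lambda>s. f (segment n i x s)) has_field_derivative
      f' (segment n i x s) * (x i - x n)) (at s)" for s
  proof -
    have "((\<lambda>v. f ((segment n i x 0)(i := v))) has_field_derivative
        f' ((segment n i x 0)(i := b s))) (at (b s))"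
      unfolding f'_def by (rule has_partial_deriv[OF cinf_Ck[OF f] i segment_in_Rn])
    moreover have "(b has_field_derivative x i - x n) (at s)"
      unfolding b_def by (auto intro!: derivative_eq_intros)
    ultimately show ?thesis
      by (subst (1 2) upd) (rule DERIV_chain2)
  qed
  have "((\<lambda>s. f' (segment n i x s) * (x i - x n)) has_integral
      f (segment n i x 1) - f (segment n i x 0)) {0..1}"
    using deriv
    by (intro fundamental_theorem_of_calculus)
      (auto simp flip: has_real_derivative_iff_has_vector_derivative intro: has_field_derivative_at_within)
  from integral_unique[OF this]
  have "f (segment n i x 1) - f (segment n i x 0) = (x i - x n) * g x"
    by (simp add: g_def segment_integral_def mult.commute)
  moreover have "segment n i x 1 = (\<lambda>j\<in>{..<n}. x j)"
    unfolding segment_def by (intro restrict_ext) simp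
  moreover have "segment n i x 0 = (\<lambda>j\<in>{..<n}. if j = i then x n else x j)"
    unfolding segment_def by (intro restrict_ext) simp
  ultimately show "f (\<lambda>j\<in>{..<n}. x j) - f (\<lambda>j\<in>{..<n}. if j = i then x n else x j)
      = (x i - x n) * restrict g (Rn (Suc n)) x"
    using x by simp
qed

section \<open>Operations in the underlying algebra\<close>

lemma carrier_underlying [simp]: "carrier (underlying A) = carrier A"
  by (simp add: underlying_def)

lemma tuple_map: "tuple (map h xs) = (\<lambda>i\<in>{..<length xs}. h (tuple xs i))"
  unfolding tuple_def by (auto simp: fun_eq_iff)

lemma tuple_in_tuples: "set xs \<subseteq> X \<Longrightarrow> length xs = n \<Longrightarrow> tuple xs \<in> tuples n X"
  unfolding tuple_def by (auto intro!: tuplesI)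

lemma algebra_operations_cinf:
  "(\<lambda>x\<in>Rn 2. x 0 + x 1) \<in> cinf 2" "(\<lambda>x\<in>Rn 2. x 0 * x 1) \<in> cinf 2"
  "(\<lambda>x\<in>Rn 0. c) \<in> cinf 0" "(\<lambda>x\<in>Rn 1. c * x 0) \<in> cinf 1"
  by (intro cinf_restrictI Ck_add Ck_mult Ck_const Ck_coordinate; simp)+

lemma tuple2_eval: "tuple [x, y] \<in> Rn 2" "tuple [x, y] 0 = x" "tuple [x, y] 1 = y" for x y :: real
  using tuple_in_tuples[of "[x, y]" UNIV 2] by (simp_all add: tuple_def)

context cinf_ring
begin

lemma op_binary:
  assumes "F \<in> cinf 2" "f \<in> cinf m" "g \<in> cinf m" "a \<in> tuples m (carrier A)"
  shows "cinf_op A m (\<lambda>x\<in>Rn m. F (tuple [f x, g x])) a =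
    cinf_op A 2 F (tuple [cinf_op A m f a, cinf_op A m g a])"
proof -
  have "[f, g] ! i \<in> cinf m" if "i < 2" for i
    using that assms less_2_cases by fastforce
  then have "cinf_op A m (\<lambda>x\<in>Rn m. F (\<lambda>i\<in>{..<2}. ([f, g] ! i) x)) a =
      cinf_op A 2 F (\<lambda>i\<in>{..<2}. cinf_op A m ([f, g] ! i) a)"
    by (intro op_comp[where g = "\<lambda>i. [f, g] ! i"] assms)
  moreover have "(\<lambda>i\<in>{..<2}. ([f, g] ! i) x) = tuple [f x, g x]" for x
    unfolding tuple_def by (auto simp: fun_eq_iff less_2_cases_iff)
  moreover have "(\<lambda>i\<in>{..<2}. cinf_op A m ([f, g] ! i) a) = tuple [cinf_op A m f a, cinf_op A m g a]"
    unfolding tuple_def by (auto simp: fun_eq_iff less_2_cases_iff)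
  ultimately show ?thesis by (simp only:)
qed

lemma op_add:
  assumes "f \<in> cinf m" "g \<in> cinf m" "a \<in> tuples m (carrier A)"
  shows "cinf_op A m (\<lambda>x\<in>Rn m. f x + g x) a =
    cinf_op A m f a \<oplus>\<^bsub>underlying A\<^esub> cinf_op A m g a"
  using op_binary[OF algebra_operations_cinf(1) assms] tuple2_eval
  by (simp add: underlying_def)

lemma op_mult:
  assumes "f \<in> cinf m" "g \<in> cinf m" "a \<in> tuples m (carrier A)"
  shows "cinf_op A m (\<lambda>x\<in>Rn m. f x * g x) a =
    cinf_op A m f a \<otimes>\<^bsub>underlying A\<^esub> cinf_op A m g a"
  using op_binary[OF algebra_operations_cinf(2) assms] tuple2_eval
  by (simp add: underlying_def)

text \<open>
  An operation with permuted or repeated arguments is a composition with coordinate functions; this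
  embeds an \<open>n\<close>-ary operation among those with more variables.
\<close>

lemma op_reindex:
  assumes "f \<in> cinf n" "\<And>j. j < n \<Longrightarrow> \<sigma> j < m" "a \<in> tuples m (carrier A)"
  shows "cinf_op A m (\<lambda>x\<in>Rn m. f (\<lambda>j\<in>{..<n}. x (\<sigma> j))) a = cinf_op A n f (\<lambda>j\<in>{..<n}. a (\<sigma> j))"
proof -
  have g: "(\<lambda>x\<in>Rn m. x (\<sigma> j)) \<in> cinf m" if "j < n" for j
    using assms(2)[OF that] by (intro cinf_restrictI Ck_coordinate)
  have "(\<lambda>x\<in>Rn m. f (\<lambda>j\<in>{..<n}. x (\<sigma> j))) = (\<lambda>x\<in>Rn m. f (\<lambda>j\<in>{..<n}. (\<lambda>x\<in>Rn m. x (\<sigma> j)) x))"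
    by (intro restrict_ext) simp
  moreover have "(\<lambda>j\<in>{..<n}. cinf_op A m (\<lambda>x\<in>Rn m. x (\<sigma> j)) a) = (\<lambda>j\<in>{..<n}. a (\<sigma> j))"
    using assms by (intro restrict_ext) (simp add: op_coordinate)
  ultimately show ?thesis
    using op_comp[OF assms(1) g assms(3)] by simp
qed

lemma smult_closed:
  "a \<in> carrier A \<Longrightarrow> r \<odot>\<^bsub>underlying A\<^esub> a \<in> carrier A"
  using op_closed[OF algebra_operations_cinf(4)] tuple_in_tuples[of "[a]" "carrier A" 1]
  by (simp add: underlying_def)

end

section \<open>The quotient by an ideal\<close>

locale cinf_ideal = cinf_ring A + M?: ideal I "underlying A"
  for A :: "'a cinf_ring" and I :: "'a set"
begin

abbreviation "p \<equiv> cinf_proj A I"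
abbreviation "Q \<equiv> cinf_quot A I"

lemmas algebra_closed [simp] =
  M.a_closed[simplified] M.m_closed[simplified] M.a_inv_closed[simplified]

lemma proj_self: "a \<in> carrier A \<Longrightarrow> a \<in> p a"
  using M.a_rcos_self by (simp add: cinf_proj_def)

lemma proj_rep:
  assumes "a \<in> carrier A" "b \<in> p a"
  shows "b \<in> carrier A" "p b = p a"
  using assms M.a_elemrcos_carrier[of a b] M.a_repr_independence'[of b a]
  by (simp_all add: cinf_proj_def)

lemma proj_memD:
  assumes "b \<in> p a"
  obtains h where "h \<in> I" "b = h \<oplus>\<^bsub>underlying A\<^esub> a"
  using assms by (auto simp: cinf_proj_def a_r_coset_def')

lemma proj_absorb:
  assumes "h \<in> I" "a \<in> carrier A"
  shows "p (h \<oplus>\<^bsub>underlying A\<^esub> a) = p a"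
  by (rule proj_rep[OF assms(2)]) (use assms in \<open>auto simp: cinf_proj_def a_r_coset_def'\<close>)

lemma carrier_quot: "carrier Q = p ` carrier A"
  by (auto simp: cinf_quot_def cinf_proj_def A_RCOSETS_def')

lemma carrier_quotE:
  assumes "X \<in> carrier Q"
  obtains a where "a \<in> carrier A" "X = p a"
  using assms by (auto simp: carrier_quot)

text \<open>
  Hadamard's identity is evaluated at \<open>a\<close> with \<open>b\<close> as an extra coordinate. It is used in the form
  \<open>f(x(i := x\<^sub>n)) + x\<^sub>i g = f(x) + x\<^sub>n g\<close>, free of subtraction, so that only addition and
  multiplication have to be matched with the ring operations.
\<close>

lemma proj_op_upd:
  assumes f: "f \<in> cinf n" and a: "a \<in> tuples n (carrier A)" and i: "i < n"
    and b: "b \<in> carrier A" "p b = p (a i)"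
  shows "p (cinf_op A n f (a(i := b))) = p (cinf_op A n f a)"
proof -
  obtain g where g: "g \<in> cinf (Suc n)"
    and fg: "\<And>x. x \<in> Rn (Suc n) \<Longrightarrow>
      f (\<lambda>j\<in>{..<n}. x j) - f (\<lambda>j\<in>{..<n}. if j = i then x n else x j) = (x i - x n) * g x"
    using hadamard_one_variable[OF f i] by blast
  \<comment> \<open>reads the \<open>i\<close>-th argument of \<open>f\<close> from the extra coordinate, where \<open>c\<close> below stores \<open>b\<close>\<close>
  define \<sigma> where "\<sigma> j = (if j = i then n else j)" for j
  define X where "X l = (\<lambda>x\<in>Rn (Suc n). x l)" for l
  define F where "F \<tau> = (\<lambda>x\<in>Rn (Suc n). f (\<lambda>j\<in>{..<n}. x (\<tau> j)))" for \<tau> :: "nat \<Rightarrow> nat"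
  define c where "c = (\<lambda>j\<in>{..<Suc n}. if j = n then b else a j)"
  define \<gamma> where "\<gamma> = cinf_op A (Suc n) g c"
  have c: "c \<in> tuples (Suc n) (carrier A)"
    unfolding c_def using a b by (intro tuplesI) (auto simp: less_Suc_eq tuples_memb)
  have X: "X l \<in> cinf (Suc n)" "cinf_op A (Suc n) (X l) c = c l" if "l < Suc n" for l
    unfolding X_def using that c by (auto intro!: cinf_restrictI Ck_coordinate op_coordinate)
  have \<sigma>: "\<sigma> j < Suc n" if "j < n" for j using that by (simp add: \<sigma>_def)
  have F: "F \<tau> \<in> cinf (Suc n)" if "inj_on \<tau> {..<n}" "\<And>j. j < n \<Longrightarrow> \<tau> j < Suc n" for \<tau>
    unfolding F_def by (intro cinf_restrictI Ck_reindex that cinf_Ck f)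
  have "inj_on \<sigma> {..<n}" "inj_on (\<lambda>j. j) {..<n}"
    by (auto simp: inj_on_def \<sigma>_def)
  then have F: "F \<sigma> \<in> cinf (Suc n)" "F (\<lambda>j. j) \<in> cinf (Suc n)"
    using \<sigma> by (auto intro: F)
  have Fc: "cinf_op A (Suc n) (F \<tau>) c = cinf_op A n f (\<lambda>j\<in>{..<n}. c (\<tau> j))"
    if "\<And>j. j < n \<Longrightarrow> \<tau> j < Suc n" for \<tau>
    unfolding F_def by (rule op_reindex[OF f that c])
  have "(\<lambda>j\<in>{..<n}. c (\<sigma> j)) = a(i := b)" "(\<lambda>j\<in>{..<n}. c j) = a"
    using i a by (auto simp: fun_eq_iff c_def \<sigma>_def tuples_def PiE_def extensional_def)
  with Fc[of \<sigma>] Fc[of "\<lambda>j. j"] \<sigma> have Fc: "cinf_op A (Suc n) (F \<sigma>) c = cinf_op A n f (a(i := b))"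
      "cinf_op A (Suc n) (F (\<lambda>j. j)) c = cinf_op A n f a"
    by simp_all
  define P where "P l = (\<lambda>x\<in>Rn (Suc n). X l x * g x)" for l
  have P: "P l \<in> cinf (Suc n)" "cinf_op A (Suc n) (P l) c = c l \<otimes>\<^bsub>underlying A\<^esub> \<gamma>"
    if "l < Suc n" for l
  proof -
    show "P l \<in> cinf (Suc n)"
      unfolding P_def by (intro cinf_restrictI Ck_mult cinf_Ck X(1) g that)
    show "cinf_op A (Suc n) (P l) c = c l \<otimes>\<^bsub>underlying A\<^esub> \<gamma>"
      using op_mult[OF X(1)[OF that] g c] X(2)[OF that] by (simp add: P_def \<gamma>_def)
  qed
  have "(\<lambda>x\<in>Rn (Suc n). F \<sigma> x + P i x) = (\<lambda>x\<in>Rn (Suc n). F (\<lambda>j. j) x + P n x)"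
  proof (rule restrict_ext)
    fix x assume x: "x \<in> Rn (Suc n)"
    have "(\<lambda>j\<in>{..<n}. x (\<sigma> j)) = (\<lambda>j\<in>{..<n}. if j = i then x n else x j)"
      by (intro restrict_ext) (simp add: \<sigma>_def)
    with fg[OF x] x show "F \<sigma> x + P i x = F (\<lambda>j. j) x + P n x"
      by (simp add: F_def P_def X_def algebra_simps)
  qed
  then have "cinf_op A (Suc n) (\<lambda>x\<in>Rn (Suc n). F \<sigma> x + P i x) c =
      cinf_op A (Suc n) (\<lambda>x\<in>Rn (Suc n). F (\<lambda>j. j) x + P n x) c"
    by (rule arg_cong)
  moreover have "c i = a i" "c n = b" using i by (auto simp: c_def)
  ultimately have eq: "cinf_op A n f (a(i := b)) \<oplus>\<^bsub>underlying A\<^esub> a i \<otimes>\<^bsub>underlying A\<^esub> \<gamma> =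
      cinf_op A n f a \<oplus>\<^bsub>underlying A\<^esub> b \<otimes>\<^bsub>underlying A\<^esub> \<gamma>"
    using i by (simp add: op_add[OF F(1) P(1) c] op_add[OF F(2) P(1) c] P Fc)
  obtain h where h: "h \<in> I" "b = h \<oplus>\<^bsub>underlying A\<^esub> a i"
    using proj_memD proj_self b by metis
  have carr: "h \<in> carrier A" "a i \<in> carrier A" "\<gamma> \<in> carrier A"
      "cinf_op A n f a \<in> carrier A" "cinf_op A n f (a(i := b)) \<in> carrier A"
    using M.Icarr[OF h(1)] a i b f g c
    by (auto simp: \<gamma>_def tuples_memb op_closed tuples_upd)
  have "cinf_op A n f (a(i := b)) = h \<otimes>\<^bsub>underlying A\<^esub> \<gamma> \<oplus>\<^bsub>underlying A\<^esub> cinf_op A n f a"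
  proof -
    let ?z = "a i \<otimes>\<^bsub>underlying A\<^esub> \<gamma>"
    have "cinf_op A n f (a(i := b)) \<oplus>\<^bsub>underlying A\<^esub> ?z =
        (h \<otimes>\<^bsub>underlying A\<^esub> \<gamma> \<oplus>\<^bsub>underlying A\<^esub> cinf_op A n f a) \<oplus>\<^bsub>underlying A\<^esub> ?z"
      unfolding eq unfolding h(2) using carr by (simp add: M.l_distr M.a_ac)
    then show ?thesis
      using carr by (subst (asm) M.add.right_cancel) auto
  qed
  then show ?thesis
    using h carr by (simp add: proj_absorb M.I_r_closed)
qed

text \<open>
  The arguments are exchanged one after the other through tuples \<open>h k\<close> that agree with \<open>b\<close> below \<open>k\<close>
  and with \<open>a\<close> from \<open>k\<close> on.
\<close>

lemma proj_op_cong: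
  assumes f: "f \<in> cinf n" and a: "a \<in> tuples n (carrier A)" and b: "b \<in> tuples n (carrier A)"
    and eq: "\<And>i. i < n \<Longrightarrow> p (b i) = p (a i)"
  shows "p (cinf_op A n f b) = p (cinf_op A n f a)"
proof -
  define h where "h k = (\<lambda>j\<in>{..<n}. if j < k then b j else a j)" for k
  have "k \<le> n \<Longrightarrow> p (cinf_op A n f (h k)) = p (cinf_op A n f a)" for k
  proof (induction k)
    case 0
    then show ?case using tuples_restrict[OF a] by (simp add: h_def)
  next
    case (Suc k)
    have "h (Suc k) = (h k)(k := b k)"
      using Suc.prems by (auto simp: h_def fun_eq_iff less_Suc_eq)
    moreover have "h k \<in> tuples n (carrier A)"
      unfolding h_def using a b by (intro tuplesI) (simp add: tuples_memb)
    moreover have "p (b k) = p (h k k)"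
      using Suc.prems eq by (simp add: h_def)
    ultimately have "p (cinf_op A n f (h (Suc k))) = p (cinf_op A n f (h k))"
      using proj_op_upd[OF f, of "h k" k "b k"] Suc.prems b by (simp only: tuples_memb Suc_le_eq)
    with Suc show ?case by simp
  qed
  from this[of n] show ?thesis
    using tuples_restrict[OF b] by (simp add: h_def cong: restrict_cong)
qed

text \<open>
  An operation that respects congruence modulo \<open>I\<close> takes a single coset as value, so the union over
  representatives collapses. The hypothesis is congruence and not membership in \<open>cinf\<close>, in order to
  cover composites \<open>f \<circ> g\<close>: their operations inherit congruence from \<open>f\<close> and \<open>g\<close>, whereas their
  smoothness would require a chain rule in several variables.
\<close>

lemma quot_op_eqI:
  assumes a: "a \<in> tuples n (carrier A)"
    and cong: "\<And>b. b \<in> tuples n (carrier A) \<Longrightarrow> (\<And>i. i < n \<Longrightarrow> p (b i) = p (a i)) \<Longrightarrow>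
      p (cinf_op A n f b) = p (cinf_op A n f a)"
  shows "cinf_op Q n f (\<lambda>i\<in>{..<n}. p (a i)) = p (cinf_op A n f a)"
proof -
  let ?R = "Pi\<^sub>E {..<n} (\<lambda>i\<in>{..<n}. p (a i))"
  have "p (cinf_op A n f b) = p (cinf_op A n f a)" if b: "b \<in> ?R" for b
  proof (rule cong)
    have "b i \<in> p (a i)" if "i < n" for i
      using PiE_mem[OF b, of i] that by simp
    note rep = proj_rep[OF tuples_memb[OF a] this]
    show "b \<in> tuples n (carrier A)"
      using b rep(1) unfolding tuples_def PiE_iff by blast
    show "p (b i) = p (a i)" if "i < n" for i
      using that that by (rule rep(2))
  qed
  moreover have "a \<in> ?R"
    using a proj_self by (auto simp: tuples_def PiE_iff)
  ultimately have "(\<Union>b\<in>?R. p (cinf_op A n f b)) = p (cinf_op A n f a)"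
    by blast
  then show ?thesis by (simp add: cinf_quot_def cinf_proj_def)
qed

lemma quot_op_proj:
  assumes "f \<in> cinf n" "a \<in> tuples n (carrier A)"
  shows "cinf_op Q n f (\<lambda>i\<in>{..<n}. p (a i)) = p (cinf_op A n f a)"
  using assms by (intro quot_op_eqI proj_op_cong)

lemma quot_tupleE:
  assumes "X \<in> tuples n (carrier Q)"
  obtains a where "a \<in> tuples n (carrier A)" "X = (\<lambda>i\<in>{..<n}. p (a i))"
proof
  define r where "r i = (SOME a. a \<in> carrier A \<and> p a = X i)" for i
  have r: "r i \<in> carrier A \<and> p (r i) = X i" if "i < n" for i
  proof -
    from tuples_memb[OF assms that] have "\<exists>a. a \<in> carrier A \<and> p a = X i"
      by (auto simp: carrier_quot)
    then show ?thesis unfolding r_def by (rule someI_ex)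
  qed
  then show "(\<lambda>i\<in>{..<n}. r i) \<in> tuples n (carrier A)"
    by (intro tuplesI) simp
  have "(\<lambda>i\<in>{..<n}. p ((\<lambda>i\<in>{..<n}. r i) i)) = (\<lambda>i\<in>{..<n}. X i)"
    using r by (intro restrict_ext) simp
  then show "X = (\<lambda>i\<in>{..<n}. p ((\<lambda>i\<in>{..<n}. r i) i))"
    using tuples_restrict[OF assms] by simp
qed

lemma cinf_ring_quot: "cinf_ring Q"
proof
  fix f n and X :: "nat \<Rightarrow> 'a set"
  assume f: "f \<in> cinf n" and X: "X \<in> tuples n (carrier Q)"
  from X obtain a where "a \<in> tuples n (carrier A)" "X = (\<lambda>i\<in>{..<n}. p (a i))"
    by (rule quot_tupleE)
  with f show "cinf_op Q n f X \<in> carrier Q"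
    by (simp add: quot_op_proj carrier_quot op_closed)
next
  fix i n and X :: "nat \<Rightarrow> 'a set"
  assume i: "i < n" and X: "X \<in> tuples n (carrier Q)"
  from X obtain a where a: "a \<in> tuples n (carrier A)" "X = (\<lambda>i\<in>{..<n}. p (a i))"
    by (rule quot_tupleE)
  have "(\<lambda>x\<in>Rn n. x i) \<in> cinf n"
    using i by (intro cinf_restrictI Ck_coordinate)
  with a i show "cinf_op Q n (\<lambda>x\<in>Rn n. x i) X = X i"
    by (simp add: quot_op_proj op_coordinate)
next
  fix f n m and g :: "nat \<Rightarrow> (nat \<Rightarrow> real) \<Rightarrow> real" and X :: "nat \<Rightarrow> 'a set"
  assume f: "f \<in> cinf n" and g: "\<And>i. i < n \<Longrightarrow> g i \<in> cinf m"
    and X: "X \<in> tuples m (carrier Q)"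
  from X obtain a where a: "a \<in> tuples m (carrier A)" "X = (\<lambda>i\<in>{..<m}. p (a i))"
    by (rule quot_tupleE)
  let ?fg = "\<lambda>x\<in>Rn m. f (\<lambda>i\<in>{..<n}. g i x)"
  let ?G = "\<lambda>b. \<lambda>i\<in>{..<n}. cinf_op A m (g i) b"
  have G: "?G b \<in> tuples n (carrier A)" if "b \<in> tuples m (carrier A)" for b
    using that g by (intro tuplesI op_closed)
  have "cinf_op Q m ?fg X = p (cinf_op A m ?fg a)"
    unfolding a(2)
  proof (rule quot_op_eqI[OF a(1)])
    fix b assume b: "b \<in> tuples m (carrier A)" "\<And>i. i < m \<Longrightarrow> p (b i) = p (a i)"
    have "p (cinf_op A n f (?G b)) = p (cinf_op A n f (?G a))"
    proof (rule proj_op_cong[OF f G[OF a(1)] G[OF b(1)]])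
      fix i assume "i < n"
      with proj_op_cong[OF g a(1) b] show "p (?G b i) = p (?G a i)" by simp
    qed
    then show "p (cinf_op A m ?fg b) = p (cinf_op A m ?fg a)"
      using a(1) b(1) by (simp only: op_comp[OF f g])
  qed
  also have "\<dots> = p (cinf_op A n f (?G a))"
    using a(1) by (simp only: op_comp[OF f g])
  also have "\<dots> = cinf_op Q n f (\<lambda>i\<in>{..<n}. p (?G a i))"
    using G[OF a(1)] f by (simp only: quot_op_proj)
  also have "(\<lambda>i\<in>{..<n}. p (?G a i)) = (\<lambda>i\<in>{..<n}. cinf_op Q m (g i) X)"
    using a g by (intro restrict_ext) (simp add: quot_op_proj)
  finally show "cinf_op Q m ?fg X = cinf_op Q n f (\<lambda>i\<in>{..<n}. cinf_op Q m (g i) X)" .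
qed

lemma proj_cinf_hom: "p \<in> cinf_hom A Q"
  unfolding cinf_hom_def by (auto simp: quot_op_proj carrier_quot)

lemma proj_op_tuple:
  assumes "f \<in> cinf n" "set xs \<subseteq> carrier A" "length xs = n"
  shows "p (cinf_op A n f (tuple xs)) = cinf_op Q n f (tuple (map p xs))"
  using quot_op_proj[OF assms(1) tuple_in_tuples[OF assms(2,3)]] assms(3) by (simp only: tuple_map)

lemma proj_smult:
  "a \<in> carrier A \<Longrightarrow> p (r \<odot>\<^bsub>underlying A\<^esub> a) = r \<odot>\<^bsub>underlying Q\<^esub> p a"
  using proj_op_tuple[OF algebra_operations_cinf(4), of "[a]" r] by (simp add: underlying_def)

lemma proj_zero: "p \<zero>\<^bsub>underlying A\<^esub> = \<zero>\<^bsub>underlying Q\<^esub>"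
  using proj_op_tuple[OF algebra_operations_cinf(3), of "[]" 0] by (simp add: underlying_def)

lemma proj_ring_hom: "p \<in> ring_hom (underlying A) (underlying Q)"
proof (rule ring_hom_memI)
  fix a b assume "a \<in> carrier (underlying A)" "b \<in> carrier (underlying A)"
  then have ab: "set [a, b] \<subseteq> carrier A" by simp
  show "p (a \<otimes>\<^bsub>underlying A\<^esub> b) = p a \<otimes>\<^bsub>underlying Q\<^esub> p b"
    using proj_op_tuple[OF algebra_operations_cinf(2) ab] by (simp add: underlying_def)
  show "p (a \<oplus>\<^bsub>underlying A\<^esub> b) = p a \<oplus>\<^bsub>underlying Q\<^esub> p b"
    using proj_op_tuple[OF algebra_operations_cinf(1) ab] by (simp add: underlying_def)
next
  show "p \<one>\<^bsub>underlying A\<^esub> = \<one>\<^bsub>underlying Q\<^esub>"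
    using proj_op_tuple[OF algebra_operations_cinf(3), of "[]" 1] by (simp add: underlying_def)
qed (simp add: carrier_quot)

text \<open>
  The homomorphic image of a ring is a ring, and the projection is onto.
\<close>

lemma proj_ring_hom_ring: "ring_hom_ring (underlying A) (underlying Q) p"
proof -
  have "(underlying Q)\<lparr>carrier := p ` carrier (underlying A), zero := p \<zero>\<^bsub>underlying A\<^esub>\<rparr>
      = underlying Q"
    by (simp add: proj_zero carrier_quot[symmetric])
  then have "ring (underlying Q)"
    using M.ring_hom_imp_img_ring[OF proj_ring_hom] by simp
  then show ?thesis
    using M.ring_axioms proj_ring_hom by (intro ring_hom_ringI2)
qed

end

section \<open>The bracket on the quotient\<close>

locale poisson_cinf_ideal = poisson_cinf_ring A br + cinf_ideal A I
  for A :: "'a cinf_ring" and br :: "'a \<Rightarrow> 'a \<Rightarrow> 'a" and I :: "'a set" +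
  assumes bracket_ideal: "\<lbrakk>h \<in> I; a \<in> carrier A\<rbrakk> \<Longrightarrow> br h a \<in> I"
begin

definition quot_bracket :: "'a set \<Rightarrow> 'a set \<Rightarrow> 'a set" where
  "quot_bracket X Y = (\<Union>a\<in>X. \<Union>b\<in>Y. p (br a b))"

lemma bracket_carrier: "\<lbrakk>a \<in> carrier A; b \<in> carrier A\<rbrakk> \<Longrightarrow> br a b \<in> carrier A"
  using bracket_closed by simp

lemma bracket_ideal_right:
  assumes "h \<in> I" "a \<in> carrier A"
  shows "br a h \<in> I"
  using bracket_antisym[of a h] bracket_ideal[OF assms] M.Icarr[OF assms(1)] assms(2)
    M.a_inv_closed by simp

lemma proj_bracket_cong:
  assumes a: "a \<in> carrier A" and b: "b \<in> carrier A" and a': "a' \<in> p a" and b': "b' \<in> p b"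
  shows "p (br a' b') = p (br a b)"
proof -
  from a' obtain h where h: "h \<in> I" "a' = h \<oplus>\<^bsub>underlying A\<^esub> a" by (rule proj_memD)
  from b' obtain k where k: "k \<in> I" "b' = k \<oplus>\<^bsub>underlying A\<^esub> b" by (rule proj_memD)
  have carr: "h \<in> carrier A" "k \<in> carrier A" "b' \<in> carrier A"
    using M.Icarr h(1) k(1) proj_rep(1)[OF b b'] by auto
  have "p (br a' b') = p (br h b' \<oplus>\<^bsub>underlying A\<^esub> br a b')"
    using carr a by (simp add: h(2) bracket_add_left)
  also have "\<dots> = p (br a b')"
    using carr a h by (simp add: proj_absorb bracket_ideal bracket_carrier)
  also have "\<dots> = p (br a k \<oplus>\<^bsub>underlying A\<^esub> br a b)"
    using carr a b by (simp add: k(2) bracket_add_right)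
  also have "\<dots> = p (br a b)"
    using carr a b k by (simp add: proj_absorb bracket_ideal_right bracket_carrier)
  finally show ?thesis .
qed

lemma quot_bracket_proj:
  assumes "a \<in> carrier A" "b \<in> carrier A"
  shows "quot_bracket (p a) (p b) = p (br a b)"
  unfolding quot_bracket_def
  using proj_bracket_cong[OF assms] proj_self[OF assms(1)] proj_self[OF assms(2)] by blast

lemma proj_a_inv: "a \<in> carrier A \<Longrightarrow> p (\<ominus>\<^bsub>underlying A\<^esub> a) = \<ominus>\<^bsub>underlying Q\<^esub> p a"
proof -
  interpret H: ring_hom_ring "underlying A" "underlying Q" p
    by (rule proj_ring_hom_ring)
  show "a \<in> carrier A \<Longrightarrow> p (\<ominus>\<^bsub>underlying A\<^esub> a) = \<ominus>\<^bsub>underlying Q\<^esub> p a"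
    by (rule H.hom_a_inv) simp
qed

text \<open>
  Rewriting with these rules pulls every operation on cosets of representatives inside the
  projection, which reduces the axioms for the quotient bracket to those for \<open>br\<close>.
\<close>

lemmas proj_hom = ring_hom_add[OF proj_ring_hom, simplified, symmetric]
  ring_hom_mult[OF proj_ring_hom, simplified, symmetric]
  proj_a_inv[symmetric] proj_smult[symmetric] proj_zero[symmetric]
  quot_bracket_proj bracket_carrier smult_closed

lemma poisson_bracket_quot: "poisson_bracket (underlying Q) quot_bracket"
proof
  fix X Y assume "X \<in> carrier (underlying Q)" "Y \<in> carrier (underlying Q)"
  then obtain a b where ab: "a \<in> carrier A" "b \<in> carrier A" and X: "X = p a" "Y = p b"
    by (auto simp: carrier_quot)
  show "quot_bracket X Y \<in> carrier (underlying Q)"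
    using ab by (simp add: X proj_hom carrier_quot)
  show "quot_bracket X Y = \<ominus>\<^bsub>underlying Q\<^esub> quot_bracket Y X"
    using ab bracket_antisym[of a b] by (simp add: X proj_hom)
  show "quot_bracket (r \<odot>\<^bsub>underlying Q\<^esub> X) Y = r \<odot>\<^bsub>underlying Q\<^esub> quot_bracket X Y" for r
    using ab by (simp add: X proj_hom bracket_smult_left)
  show "quot_bracket X (r \<odot>\<^bsub>underlying Q\<^esub> Y) = r \<odot>\<^bsub>underlying Q\<^esub> quot_bracket X Y" for r
    using ab by (simp add: X proj_hom bracket_smult_right)
  fix Z assume "Z \<in> carrier (underlying Q)"
  then obtain c where c: "c \<in> carrier A" and Z: "Z = p c"
    by (auto simp: carrier_quot)
  show "quot_bracket (X \<oplus>\<^bsub>underlying Q\<^esub> Y) Z =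
      quot_bracket X Z \<oplus>\<^bsub>underlying Q\<^esub> quot_bracket Y Z"
    using ab c by (simp add: X Z proj_hom bracket_add_left)
  show "quot_bracket X (Y \<oplus>\<^bsub>underlying Q\<^esub> Z) =
      quot_bracket X Y \<oplus>\<^bsub>underlying Q\<^esub> quot_bracket X Z"
    using ab c by (simp add: X Z proj_hom bracket_add_right)
  show "quot_bracket X (quot_bracket Y Z) \<oplus>\<^bsub>underlying Q\<^esub>
      quot_bracket Y (quot_bracket Z X) \<oplus>\<^bsub>underlying Q\<^esub>
      quot_bracket Z (quot_bracket X Y) = \<zero>\<^bsub>underlying Q\<^esub>"
    using ab c bracket_jacobi[of a b c] by (simp add: X Z proj_hom)
  show "quot_bracket X (Y \<otimes>\<^bsub>underlying Q\<^esub> Z) =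
      quot_bracket X Y \<otimes>\<^bsub>underlying Q\<^esub> Z \<oplus>\<^bsub>underlying Q\<^esub>
      Y \<otimes>\<^bsub>underlying Q\<^esub> quot_bracket X Z"
    using ab c by (simp add: X Z proj_hom bracket_leibniz)
qed

text \<open>
  The derivation property is the projection of the formula in \<open>A\<close>, because a ring homomorphism
  commutes with finite sums.
\<close>

lemma poisson_quot: "poisson_cinf_ring Q quot_bracket"
proof -
  interpret H: ring_hom_ring "underlying A" "underlying Q" p
    by (rule proj_ring_hom_ring)
  have "cinf_derivation Q (quot_bracket X)" if X: "X \<in> carrier Q" for X
    unfolding cinf_derivation_def
  proof (intro conjI allI impI ballI)
    obtain a where a: "a \<in> carrier A" "X = p a" using X by (rule carrier_quotE)
    show "quot_bracket X \<in> carrier Q \<rightarrow> carrier Q"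
      using a by (auto simp: carrier_quot quot_bracket_proj bracket_carrier)
    fix n f Y assume n: "0 < n" and f: "f \<in> cinf n" and Y: "Y \<in> tuples n (carrier Q)"
    obtain b where b: "b \<in> tuples n (carrier A)" "Y = (\<lambda>i\<in>{..<n}. p (b i))"
      using Y by (rule quot_tupleE)
    let ?t = "\<lambda>i. cinf_op A n (partial_deriv n i f) b \<otimes>\<^bsub>underlying A\<^esub> br a (b i)"
    let ?T = "\<lambda>i. cinf_op Q n (partial_deriv n i f) Y \<otimes>\<^bsub>underlying Q\<^esub> quot_bracket X (Y i)"
    have D: "cinf_op A n (partial_deriv n i f) b \<in> carrier A" "b i \<in> carrier A" if "i < n" for i
      using that b f by (auto intro: op_closed cinf_partial_deriv tuples_memb)
    have t: "?t \<in> {..<n} \<rightarrow> carrier (underlying A)"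
      using D a by (auto intro: M.m_closed[simplified] bracket_carrier)
    have pt: "p (?t i) = ?T i" if "i < n" for i
      using that D a b f by (simp add: H.hom_mult quot_bracket_proj bracket_carrier
          quot_op_proj cinf_partial_deriv)
    have "quot_bracket X (cinf_op Q n f Y) = p (br a (cinf_op A n f b))"
      using a b f by (simp add: quot_op_proj quot_bracket_proj op_closed)
    also have "br a (cinf_op A n f b) = (\<Oplus>\<^bsub>underlying A\<^esub>i\<in>{..<n}. ?t i)"
      using bracket_derivation[OF a(1)] n f b(1) by (simp add: cinf_derivation_def)
    also have "p \<dots> = (\<Oplus>\<^bsub>underlying Q\<^esub>i\<in>{..<n}. (p \<circ> ?t) i)"
      using t by (rule H.hom_finsum)
    also have "\<dots> = (\<Oplus>\<^bsub>underlying Q\<^esub>i\<in>{..<n}. ?T i)"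
    proof (rule H.S.finsum_cong'[OF refl])
      show "?T \<in> {..<n} \<rightarrow> carrier (underlying Q)"
      proof
        fix i assume i: "i \<in> {..<n}"
        then have "?t i \<in> carrier A" using t by auto
        with i show "?T i \<in> carrier (underlying Q)"
          using pt[of i, symmetric] by (simp add: carrier_quot)
      qed
      show "(p \<circ> ?t) i = ?T i" if "i \<in> {..<n}" for i
        using pt[of i] that by simp
    qed
    finally show "quot_bracket X (cinf_op Q n f Y) = (\<Oplus>\<^bsub>underlying Q\<^esub>i\<in>{..<n}. ?T i)" .
  qed
  with poisson_bracket_quot cinf_ring_quot show ?thesis
    by (simp add: poisson_cinf_ring_def poisson_cinf_ring_axioms_def)
qed

lemma proj_poisson_hom: "p \<in> poisson_hom A br Q quot_bracket"
  unfolding poisson_hom_def using proj_cinf_hom by (simp add: quot_bracket_proj)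

end

theorem lemma2p12:
  fixes A :: "'a cinf_ring" and br :: "'a \<Rightarrow> 'a \<Rightarrow> 'a" and I :: "'a set"
  assumes "poisson_cinf_ring A br" and "poisson_ideal I A br"
  shows "\<exists>br'. poisson_cinf_ring (cinf_quot A I) br' \<and>
           cinf_proj A I \<in> poisson_hom A br (cinf_quot A I) br'"
proof -
  from assms have "poisson_cinf_ideal A br I"
    by (simp add: poisson_cinf_ideal_def poisson_cinf_ideal_axioms_def poisson_ideal_def
        cinf_ideal_def poisson_cinf_ring_def)
  then interpret poisson_cinf_ideal A br I .
  show ?thesis using poisson_quot proj_poisson_hom by blast
qed

end
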